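(* Let $I := (-1,1)$ and consider two second-order elliptic operators $$\mathcal{L}_i w := a_i(x)\, w'' + b_i(x)\, w' + c_i(x)\, w, \qquad x\in I, \quad i=1,2,$$ where $a_i, b_i, c_i$, $i=1,2$, are bounded functions on $[-1,1]$ satisfying, for some $\eta>0$, $$\min\{a_1(x),a_2(x)\}\ge \eta>0 \quad\text{and}\quad \max\{c_1(x),c_2(x)\}\le 0, \qquad x\in[-1,1].$$ Assume that there is a pair of functions $(u,\gamma)$ with $u\in C^4(I)\cap C^2([-1,1])$ and $\gamma\in C^2(I)\cap C([-1,1])$ satisfying $$\mathcal{L}_1 u = \gamma \ \text{ in } I, \qquad \mathcal{L}_2\gamma \le 0 \ \text{ in } I, \qquad u(\pm 1)=u'(\pm 1)=0.$$ Then either $u\equiv 0$ or $u<0$ in $I$. *)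

theory Defs
  imports "HOL-Analysis.Analysis"
begin

(* The class C^k(S) for a set S of reals without isolated points, through a chain of
   derivatives D 0 = f, D 1, ..., D k taken within S.  On an open interval these are the
   ordinary derivatives; on a compact interval they are one-sided at the endpoints, which
   gives the usual C^k up to the boundary.  Values of f outside S are irrelevant. *)
definition Ck_on :: "nat \<Rightarrow> (real \<Rightarrow> real) \<Rightarrow> real set \<Rightarrow> bool" where
  "Ck_on k f S \<longleftrightarrow>
     (\<exists>D :: nat \<Rightarrow> real \<Rightarrow> real.
        D 0 = f \<and>
        (\<forall>j<k. \<forall>x\<in>S. (D j has_real_derivative D (Suc j) x) (at x within S)) \<and>
        continuous_on S (D k))"

definition elliptic_op ::
  "(real \<Rightarrow> real) \<Rightarrow> (real \<Rightarrow> real) \<Rightarrow> (real \<Rightarrow> real) \<Rightarrow> (real \<Rightarrow> real) \<Rightarrow> real \<Rightarrow> real" where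
  "elliptic_op a b c w x = a x * deriv (deriv w) x + b x * deriv w x + c x * w x"

end

theory Submission
  imports Defs
begin

text \<open>
  Everything rests on the one-dimensional maximum principle: if \<open>L w \<ge> 0\<close> and \<open>c \<le> 0\<close>, then
  \<open>w\<close> is bounded by \<open>0\<close> as soon as its boundary values are, it touches \<open>0\<close> inside only if it
  vanishes identically (\<open>strong_max_principle\<close>), and at an end point where it reaches \<open>0\<close> from
  negative values its slope does not vanish (\<open>hopf_right\<close>, \<open>hopf_left\<close>). All of these come from a
  single barrier, \<open>exp (s * (x - e)) - 1\<close>, where \<open>\<bar>s\<bar>\<close> is so large, compared with the bounds on the
  coefficients, that the second-order term dominates.

  Applied to \<open>- \<gamma>\<close>, the principle shows that \<open>\<gamma>\<close> is nonnegative between any two points where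
  it is nonnegative. Hence \<open>\<gamma> \<ge> 0\<close> inside one central interval and \<open>\<gamma> < 0\<close> on the (possibly empty)
  pieces between it and the end points; if \<open>\<gamma>\<close> is nonnegative nowhere, a single outer piece is
  the whole interval. On an outer piece \<open>- u\<close> is a strict subsolution; if \<open>u\<close> had a nonnegative
  value there, then \<open>- u\<close> would be negative between that point and the end point, and Hopf's lemma
  would contradict the vanishing of \<open>u'\<close> at that end point. Therefore \<open>u < 0\<close> on the outer pieces
  including their inner ends (\<open>strict_supersolution_negative\<close>). On the central interval \<open>u\<close> is a
  subsolution with nonpositive boundary values, so \<open>u < 0\<close> inside it or \<open>u\<close> is identically zero on
  it. In the latter case \<open>u\<close> vanishes at both ends of the central interval, so there is no outer
  piece and \<open>u\<close> is zero everywhere.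
\<close>

section \<open>Second derivatives and the linearity of the operator\<close>

definition twice_differentiable_on :: "(real \<Rightarrow> real) \<Rightarrow> real set \<Rightarrow> bool" where
  "twice_differentiable_on w S \<longleftrightarrow>
     (\<forall>x\<in>S. (w has_real_derivative deriv w x) (at x) \<and>
            (deriv w has_real_derivative deriv (deriv w) x) (at x))"

lemma twice_differentiable_on_subset:
  "twice_differentiable_on w T \<Longrightarrow> S \<subseteq> T \<Longrightarrow> twice_differentiable_on w S"
  by (auto simp: twice_differentiable_on_def)

lemma deriv_deriv_eq:
  fixes w :: "real \<Rightarrow> real"
  assumes "open S" "\<And>x. x \<in> S \<Longrightarrow> (w has_real_derivative w1 x) (at x)"
    "\<And>x. x \<in> S \<Longrightarrow> (w1 has_real_derivative w2 x) (at x)"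
  shows "twice_differentiable_on w S"
    and "\<And>x. x \<in> S \<Longrightarrow> deriv w x = w1 x"
    and "\<And>x. x \<in> S \<Longrightarrow> deriv (deriv w) x = w2 x"
proof -
  show 1: "deriv w x = w1 x" if "x \<in> S" for x
    using assms(2)[OF that] by (rule DERIV_imp_deriv)
  have 2: "(deriv w has_real_derivative w2 x) (at x)" if "x \<in> S" for x
    by (rule has_field_derivative_transform_within_open[OF assms(3)[OF that] assms(1) that])
       (simp add: 1)
  show 3: "deriv (deriv w) x = w2 x" if "x \<in> S" for x
    using 2[OF that] by (rule DERIV_imp_deriv)
  show "twice_differentiable_on w S"
    unfolding twice_differentiable_on_def
  proof (intro ballI conjI)
    fix x assume x: "x \<in> S"
    show "(w has_real_derivative deriv w x) (at x)"
      unfolding 1[OF x] by (rule assms(2)[OF x])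
    show "(deriv w has_real_derivative deriv (deriv w) x) (at x)"
      unfolding 3[OF x] by (rule 2[OF x])
  qed
qed

lemma Ck_on_2_twice_differentiable_on:
  assumes "Ck_on 2 w S" "open S"
  shows "twice_differentiable_on w S"
proof -
  from assms(1) obtain D where D: "D 0 = w \<and>
      (\<forall>j<2. \<forall>x\<in>S. (D j has_real_derivative D (Suc j) x) (at x within S)) \<and>
      continuous_on S (D 2)"
    unfolding Ck_on_def ..
  have "(w has_real_derivative D 1 x) (at x)" if "x \<in> S" for x
    using D that assms(2) at_within_open[of x S] by (auto dest!: spec[of _ 0])
  moreover have "(D 1 has_real_derivative D 2 x) (at x)" if "x \<in> S" for x
    using D that assms(2) at_within_open[of x S] by (auto simp: numeral_2_eq_2 dest!: spec[of _ 1])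
  ultimately show ?thesis
    by (rule deriv_deriv_eq(1)[OF assms(2)])
qed

lemma elliptic_op_lincomb:
  assumes "twice_differentiable_on f S" "twice_differentiable_on g S" "open S"
  shows "twice_differentiable_on (\<lambda>x. j * f x + k * g x) S"
    and "x \<in> S \<Longrightarrow> elliptic_op a b c (\<lambda>x. j * f x + k * g x) x
           = j * elliptic_op a b c f x + k * elliptic_op a b c g x"
proof -
  have d1: "((\<lambda>x. j * f x + k * g x) has_real_derivative j * deriv f x + k * deriv g x) (at x)"
    and d2: "((\<lambda>x. j * deriv f x + k * deriv g x) has_real_derivative
               j * deriv (deriv f) x + k * deriv (deriv g) x) (at x)" if "x \<in> S" for x
    using assms(1,2) that unfolding twice_differentiable_on_def
    by (auto intro!: derivative_eq_intros)
  show "twice_differentiable_on (\<lambda>x. j * f x + k * g x) S"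
    by (rule deriv_deriv_eq(1)[OF assms(3) d1 d2])
  show "elliptic_op a b c (\<lambda>x. j * f x + k * g x) x
           = j * elliptic_op a b c f x + k * elliptic_op a b c g x" if x: "x \<in> S"
  proof -
    have "deriv (\<lambda>x. j * f x + k * g x) x = j * deriv f x + k * deriv g x"
      by (rule deriv_deriv_eq(2)[OF assms(3) d1 d2 x])
    moreover have "deriv (deriv (\<lambda>x. j * f x + k * g x)) x
                     = j * deriv (deriv f) x + k * deriv (deriv g) x"
      by (rule deriv_deriv_eq(3)[OF assms(3) d1 d2 x])
    ultimately show ?thesis
      by (simp add: elliptic_op_def algebra_simps)
  qed
qed

lemma elliptic_op_uminus:
  assumes "twice_differentiable_on f S" "open S"
  shows "twice_differentiable_on (\<lambda>x. - f x) S"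
    and "x \<in> S \<Longrightarrow> elliptic_op a b c (\<lambda>x. - f x) x = - elliptic_op a b c f x"
  using elliptic_op_lincomb[OF assms(1,1,2), where j = "-1" and k = 0] by simp_all

lemma elliptic_op_exp_barrier:
  fixes s e :: real
  shows "twice_differentiable_on (\<lambda>x. exp (s * (x - e)) - 1) UNIV"
    and "elliptic_op a b c (\<lambda>x. exp (s * (x - e)) - 1) x
           = (a x * s\<^sup>2 + b x * s + c x) * exp (s * (x - e)) - c x"
proof -
  have d1: "((\<lambda>x. exp (s * (x - e)) - 1) has_real_derivative s * exp (s * (x - e))) (at x)"
    and d2: "((\<lambda>x. s * exp (s * (x - e))) has_real_derivative s\<^sup>2 * exp (s * (x - e))) (at x)" for x
    by (auto intro!: derivative_eq_intros simp: power2_eq_square)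
  note eq = deriv_deriv_eq[OF open_UNIV d1 d2]
  show "twice_differentiable_on (\<lambda>x. exp (s * (x - e)) - 1) UNIV"
    by (rule eq(1))
  show "elliptic_op a b c (\<lambda>x. exp (s * (x - e)) - 1) x
           = (a x * s\<^sup>2 + b x * s + c x) * exp (s * (x - e)) - c x"
    unfolding elliptic_op_def eq(2)[OF UNIV_I] eq(3)[OF UNIV_I] by (simp add: algebra_simps)
qed

lemma interior_max_derivs:
  assumes tw: "twice_differentiable_on w {p<..<q}" and x: "p < x" "x < q"
    and max: "\<And>y. p < y \<Longrightarrow> y < q \<Longrightarrow> w y \<le> w x"
  shows "deriv w x = 0" "deriv (deriv w) x \<le> 0"
proof -
  have D1: "(w has_real_derivative deriv w y) (at y)" if "p < y" "y < q" for y
    using tw that by (simp add: twice_differentiable_on_def)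
  have D2: "(deriv w has_real_derivative deriv (deriv w) x) (at x)"
    using tw x by (simp add: twice_differentiable_on_def)
  show 0: "deriv w x = 0"
  proof (rule DERIV_local_max[OF D1[OF x]])
    show "0 < min (x - p) (q - x)"
      using x by simp
    show "\<forall>y. \<bar>x - y\<bar> < min (x - p) (q - x) \<longrightarrow> w y \<le> w x"
      using max by (auto simp: abs_if split: if_splits)
  qed
  show "deriv (deriv w) x \<le> 0"
  proof (rule ccontr)
    \<comment> \<open>Otherwise the slope is positive just to the right of \<open>x\<close>, and \<open>w\<close> increases there.\<close>
    assume "\<not> deriv (deriv w) x \<le> 0"
    then obtain d where d: "d > 0" "\<And>h. 0 < h \<Longrightarrow> h < d \<Longrightarrow> deriv w x < deriv w (x + h)"
      using DERIV_pos_inc_right[OF D2] by auto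
    define y where "y = x + min (d / 2) ((q - x) / 2)"
    have y: "x < y" "y < x + d" "y < q"
      using d(1) x by (auto simp: y_def min_def field_simps)
    obtain z where z: "x < z" "z < y" "w y - w x = (y - x) * deriv w z"
      using MVT2[OF y(1), of w "deriv w"] D1 x y by force
    have "0 < deriv w z"
      using d(2)[of "z - x"] z y 0 by simp
    hence "0 < w y - w x"
      using z(3) y(1) by simp
    thus False
      using max[of y] x y by simp
  qed
qed

section \<open>Maximum principles on an interval\<close>

locale elliptic_coefficients =
  fixes a b c :: "real \<Rightarrow> real" and S :: "real set" and \<eta> B C :: real
  assumes eta_pos: "0 < \<eta>" and B_nonneg: "0 \<le> B" and C_nonneg: "0 \<le> C"
    and a_ge: "x \<in> S \<Longrightarrow> \<eta> \<le> a x"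
    and b_bound: "x \<in> S \<Longrightarrow> \<bar>b x\<bar> \<le> B"
    and c_ge: "x \<in> S \<Longrightarrow> - C \<le> c x"
    and c_le: "x \<in> S \<Longrightarrow> c x \<le> 0"
begin

text \<open>
  At an interior maximum the first-order term vanishes, and the second-order term is nonpositive; so
  is the term of order zero, because \<open>c \<le> 0\<close> meets a nonnegative value of \<open>w\<close>.
\<close>

lemma elliptic_op_nonpos_at_max:
  assumes "twice_differentiable_on w {p<..<q}" "{p<..<q} \<subseteq> S" "p < x" "x < q"
    and "\<And>y. p < y \<Longrightarrow> y < q \<Longrightarrow> w y \<le> w x" and "0 \<le> w x"
  shows "elliptic_op a b c w x \<le> 0"
proof -
  have "deriv w x = 0" "deriv (deriv w) x \<le> 0"
    using interior_max_derivs[OF assms(1,3,4,5)] by auto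
  moreover have "0 \<le> a x" "c x \<le> 0"
    using a_ge[of x] c_le[of x] eta_pos assms(2-4) by auto
  ultimately show ?thesis
    using assms(6) by (simp add: elliptic_op_def mult_nonneg_nonpos mult_nonpos_nonneg add_nonpos_nonpos)
qed

lemma strict_max_principle:
  assumes "twice_differentiable_on w {p<..<q}" "{p<..<q} \<subseteq> S" "continuous_on {p..q} w"
    and pos: "\<And>x. p < x \<Longrightarrow> x < q \<Longrightarrow> 0 < elliptic_op a b c w x"
    and ends: "w p \<le> 0" "w q \<le> 0" and x: "x \<in> {p..q}"
  shows "w x \<le> 0"
proof (rule ccontr)
  assume "\<not> w x \<le> 0"
  obtain m where m: "m \<in> {p..q}" "\<And>y. y \<in> {p..q} \<Longrightarrow> w y \<le> w m"
    using continuous_attains_sup[of "{p..q}" w] assms(3) x by auto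
  have wm: "0 < w m"
    using m(2)[OF x] \<open>\<not> w x \<le> 0\<close> by simp
  have "m \<noteq> p" "m \<noteq> q"
    using wm ends by auto
  hence pq: "p < m" "m < q"
    using m(1) by auto
  have "elliptic_op a b c w m \<le> 0"
    using elliptic_op_nonpos_at_max[OF assms(1,2) pq] m(2) wm by auto
  thus False
    using pos[OF pq] by simp
qed

text \<open>
  The value \<open>K\<close> is chosen such that \<open>\<eta> * K = B + C + \<eta>\<close> and \<open>K \<ge> 1\<close>, which give
  \<open>\<eta> * K\<^sup>2 - B * K - C \<ge> \<eta>\<close>. The barrier is used with \<open>s = K\<close> and with \<open>s = - K\<close>, one for each
  end of an interval.
\<close>

definition steepness :: real where
  "steepness = (B + C) / \<eta> + 1"

lemma steepness_pos: "0 < steepness"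
  using eta_pos B_nonneg C_nonneg by (simp add: steepness_def add_nonneg_pos)

lemma steepness_dominates:
  assumes "x \<in> S" "\<bar>s\<bar> = steepness"
  shows "0 < a x * s\<^sup>2 + b x * s + c x"
proof -
  define K where "K = steepness"
  have K1: "1 \<le> K"
    using eta_pos B_nonneg C_nonneg by (simp add: K_def steepness_def)
  have K: "\<eta> * K = B + C + \<eta>"
    using eta_pos by (simp add: K_def steepness_def field_simps)
  have "s\<^sup>2 = K\<^sup>2"
    using assms(2) by (metis K_def power2_abs)
  have "\<eta> * K\<^sup>2 \<le> a x * s\<^sup>2"
    unfolding \<open>s\<^sup>2 = K\<^sup>2\<close> using a_ge[OF assms(1)] by (simp add: mult_right_mono)
  moreover have "\<bar>b x * s\<bar> \<le> B * K"
    using b_bound[OF assms(1)] assms(2) K1 by (simp add: abs_mult K_def mult_right_mono)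
  moreover have "\<eta> * K\<^sup>2 - B * K = (C + \<eta>) * K"
    using K by (simp add: power2_eq_square algebra_simps)
  moreover have "C + \<eta> \<le> (C + \<eta>) * K"
    using mult_left_mono[OF K1, of "C + \<eta>"] C_nonneg eta_pos by simp
  ultimately show ?thesis
    using c_ge[OF assms(1)] eta_pos by linarith
qed

text \<open>
  Adding a positive multiple of the barrier turns a subsolution into a strict one, so the
  strict principle applies to the sum.
\<close>

lemma barrier_principle:
  assumes w: "twice_differentiable_on w {p<..<q}" and S: "{p<..<q} \<subseteq> S"
    and cont: "continuous_on {p..q} w"
    and sub: "\<And>x. p < x \<Longrightarrow> x < q \<Longrightarrow> 0 \<le> elliptic_op a b c w x"
    and s: "\<bar>s\<bar> = steepness" and k: "0 < k"
    and ends: "w p + k * (exp (s * (p - e)) - 1) \<le> 0" "w q + k * (exp (s * (q - e)) - 1) \<le> 0"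
    and x: "x \<in> {p..q}"
  shows "w x + k * (exp (s * (x - e)) - 1) \<le> 0"
proof -
  let ?g = "\<lambda>x. exp (s * (x - e)) - 1"
  have g: "twice_differentiable_on ?g {p<..<q}"
    using elliptic_op_exp_barrier(1) by (rule twice_differentiable_on_subset) simp
  note lin = elliptic_op_lincomb[OF w g open_greaterThanLessThan, where j = 1 and k = k, simplified]
  show ?thesis
  proof (rule strict_max_principle[where w = "\<lambda>x. w x + k * ?g x", OF lin(1) S _ _ ends x])
    show "continuous_on {p..q} (\<lambda>x. w x + k * ?g x)"
      by (intro continuous_intros cont)
    fix y assume y: "p < y" "y < q"
    hence "y \<in> S"
      using S by auto
    hence "0 < elliptic_op a b c ?g y"
      using mult_pos_pos[OF steepness_dominates[OF _ s, of y] exp_gt_zero[of "s * (y - e)"]] c_le[of y]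
      by (simp add: elliptic_op_exp_barrier(2))
    thus "0 < elliptic_op a b c (\<lambda>x. w x + k * ?g x) y"
      using lin(2)[of y a b c] sub[OF y] k y by (simp add: add_nonneg_pos)
  qed
qed

lemma weak_max_principle:
  assumes "twice_differentiable_on w {p<..<q}" "{p<..<q} \<subseteq> S" "continuous_on {p..q} w"
    and "\<And>x. p < x \<Longrightarrow> x < q \<Longrightarrow> 0 \<le> elliptic_op a b c w x"
    and "w p \<le> 0" "w q \<le> 0" and x: "x \<in> {p..q}"
  shows "w x \<le> 0"
proof (rule field_le_epsilon)
  fix k :: real assume k: "0 < k"
  \<comment> \<open>With \<open>e = q\<close> the barrier lies between \<open>-1\<close> and \<open>0\<close> on \<open>{p..q}\<close>.\<close>
  let ?g = "\<lambda>x. exp (steepness * (x - q)) - 1"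
  have g: "?g p \<le> 0" "?g q \<le> 0"
    using steepness_pos x by (simp_all add: mult_nonneg_nonpos)
  have "w x + k * ?g x \<le> 0"
  proof (rule barrier_principle[OF assms(1-4) _ k _ _ x])
    show "\<bar>steepness\<bar> = steepness"
      using steepness_pos by simp
    show "w p + k * ?g p \<le> 0" "w q + k * ?g q \<le> 0"
      using assms(5,6) k g by (simp_all only: add_nonpos_nonpos mult_nonneg_nonpos less_imp_le)
  qed
  moreover have "k * (-1) \<le> k * ?g x"
    using k by (intro mult_left_mono) simp_all
  ultimately show "w x \<le> 0 + k"
    by simp
qed

text \<open>
  Hopf's lemma: a small multiple of the barrier that vanishes at \<open>q\<close> still fits between \<open>w\<close> and
  \<open>0\<close>, and the slope of the barrier at \<open>q\<close> is not zero.
\<close>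

lemma hopf_right:
  assumes "twice_differentiable_on w {p<..<q}" "{p<..<q} \<subseteq> S" "continuous_on {p..q} w"
    and "\<And>x. p < x \<Longrightarrow> x < q \<Longrightarrow> 0 \<le> elliptic_op a b c w x"
    and "p < q" "w p < 0" "w q = 0"
    and der: "(w has_real_derivative d) (at q within {p..q})"
  shows "0 < d"
proof -
  let ?s = "- steepness"
  let ?z = "\<lambda>k x. w x + k * (exp (?s * (x - q)) - 1)"
  define k where "k = - w p / exp (?s * (p - q))"
  have k: "0 < k"
    using assms(6) by (simp add: k_def divide_neg_pos)
  have z: "?z k x \<le> 0" if "x \<in> {p..q}" for x
  proof (rule barrier_principle[OF assms(1-4) _ k _ _ that])
    show "\<bar>?s\<bar> = steepness"
      using steepness_pos by simp
    have "k * exp (?s * (p - q)) = - w p"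
      by (simp add: k_def)
    thus "?z k p \<le> 0"
      using k by (simp only: right_diff_distrib)
    show "?z k q \<le> 0"
      using assms(7) by simp
  qed
  have "(?z k has_real_derivative d + k * ?s) (at q within {p..q})"
    by (auto intro!: derivative_eq_intros der)
  moreover have "\<not> d + k * ?s < 0"
  proof
    assume "d + k * ?s < 0"
    with calculation obtain h where h: "0 < h"
      "\<And>t. 0 < t \<Longrightarrow> q - t \<in> {p..q} \<Longrightarrow> t < h \<Longrightarrow> ?z k q < ?z k (q - t)"
      using has_real_derivative_neg_dec_left by blast
    define t where "t = min (h / 2) (q - p)"
    have "0 < t" "q - t \<in> {p..q}" "t < h"
      using h(1) assms(5) by (auto simp: t_def)
    thus False
      using h(2)[of t] z[of "q - t"] assms(7) by simp
  qed
  ultimately show ?thesis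
    using mult_pos_pos[OF k steepness_pos] by simp
qed

lemma hopf_left:
  assumes "twice_differentiable_on w {p<..<q}" "{p<..<q} \<subseteq> S" "continuous_on {p..q} w"
    and "\<And>x. p < x \<Longrightarrow> x < q \<Longrightarrow> 0 \<le> elliptic_op a b c w x"
    and "p < q" "w p = 0" "w q < 0"
    and der: "(w has_real_derivative d) (at p within {p..q})"
  shows "d < 0"
proof -
  let ?s = steepness
  let ?z = "\<lambda>k x. w x + k * (exp (?s * (x - p)) - 1)"
  define k where "k = - w q / exp (?s * (q - p))"
  have k: "0 < k"
    using assms(7) by (simp add: k_def divide_neg_pos)
  have z: "?z k x \<le> 0" if "x \<in> {p..q}" for x
  proof (rule barrier_principle[OF assms(1-4) _ k _ _ that])
    show "\<bar>?s\<bar> = steepness"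
      using steepness_pos by simp
    have "k * exp (?s * (q - p)) = - w q"
      by (simp add: k_def)
    thus "?z k q \<le> 0"
      using k by (simp only: right_diff_distrib)
    show "?z k p \<le> 0"
      using assms(6) by simp
  qed
  have "(?z k has_real_derivative d + k * ?s) (at p within {p..q})"
    by (auto intro!: derivative_eq_intros der)
  moreover have "\<not> 0 < d + k * ?s"
  proof
    assume "0 < d + k * ?s"
    with calculation obtain h where h: "0 < h"
      "\<And>t. 0 < t \<Longrightarrow> p + t \<in> {p..q} \<Longrightarrow> t < h \<Longrightarrow> ?z k p < ?z k (p + t)"
      using has_real_derivative_pos_inc_right by blast
    define t where "t = min (h / 2) (q - p)"
    have "0 < t" "p + t \<in> {p..q}" "t < h"
      using h(1) assms(5) by (auto simp: t_def)
    thus False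
      using h(2)[of t] z[of "p + t"] assms(6) by simp
  qed
  ultimately show ?thesis
    using mult_pos_pos[OF k steepness_pos] by simp
qed

text \<open>
  An interior zero is a maximum, so the slope there is zero; a negative value on either side would
  contradict Hopf's lemma on the interval between the two points.
\<close>

lemma strong_max_principle:
  assumes tw: "twice_differentiable_on w {p<..<q}" and S: "{p<..<q} \<subseteq> S"
    and cont: "continuous_on {p..q} w"
    and sub: "\<And>x. p < x \<Longrightarrow> x < q \<Longrightarrow> 0 \<le> elliptic_op a b c w x"
    and ends: "w p \<le> 0" "w q \<le> 0"
  shows "(\<forall>x\<in>{p..q}. w x = 0) \<or> (\<forall>x\<in>{p<..<q}. w x < 0)"
proof (rule disjCI)
  have le: "w y \<le> 0" if "y \<in> {p..q}" for y
    by (rule weak_max_principle[OF tw S cont sub ends that])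
  assume "\<not> (\<forall>x\<in>{p<..<q}. w x < 0)"
  then obtain x where x: "p < x" "x < q" and wx: "w x = 0"
    using le by (force simp: not_less intro: antisym)
  have "deriv w x = 0"
    using interior_max_derivs(1)[OF tw x] le wx by simp
  hence der: "(w has_real_derivative 0) (at x within T)" for T
    using tw x unfolding twice_differentiable_on_def
    by (metis greaterThanLessThan_iff has_field_derivative_at_within)
  show "\<forall>y\<in>{p..q}. w y = 0"
  proof (rule ccontr)
    assume "\<not> (\<forall>y\<in>{p..q}. w y = 0)"
    then obtain y where y: "y \<in> {p..q}" and wy: "w y < 0"
      using le by (force simp: less_le)
    consider "y < x" | "x < y"
      using wx wy by (metis less_irrefl linorder_neqE)
    thus False
    proof cases
      case 1
      have "(0 :: real) < 0"
      proof (rule hopf_right[OF _ _ _ _ 1 wy wx der])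
        show "twice_differentiable_on w {y<..<x}"
          using tw by (rule twice_differentiable_on_subset) (use x y in auto)
        show "continuous_on {y..x} w"
          using cont by (rule continuous_on_subset) (use x y in auto)
      qed (use S sub x y in auto)
      thus False by simp
    next
      case 2
      have "(0 :: real) < 0"
      proof (rule hopf_left[OF _ _ _ _ 2 wx wy der])
        show "twice_differentiable_on w {x<..<y}"
          using tw by (rule twice_differentiable_on_subset) (use x y in auto)
        show "continuous_on {x..y} w"
          using cont by (rule continuous_on_subset) (use x y in auto)
      qed (use S sub x y in auto)
      thus False by simp
    qed
  qed
qed

text \<open>
  If \<open>u\<close> were nonnegative at the other end as well, its negative would be a strict subsolution and
  hence negative inside; Hopf's lemma would then forbid the zero slope.
\<close>

lemma strict_supersolution_negative:
  assumes tw: "twice_differentiable_on u {p<..<q}" and S: "{p<..<q} \<subseteq> S"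
    and cont: "continuous_on {p..q} u" and "p < q"
    and super: "\<And>x. p < x \<Longrightarrow> x < q \<Longrightarrow> elliptic_op a b c u x < 0"
  shows "u q = 0 \<Longrightarrow> (u has_real_derivative 0) (at q within {p..q}) \<Longrightarrow> u p < 0"
    and "u p = 0 \<Longrightarrow> (u has_real_derivative 0) (at p within {p..q}) \<Longrightarrow> u q < 0"
proof -
  let ?w = "\<lambda>x. - u x"
  note um = elliptic_op_uminus[OF tw open_greaterThanLessThan]
  have pos: "0 < elliptic_op a b c ?w x" if "p < x" "x < q" for x
    using um(2)[of x a b c] super[OF that] that by simp
  have contw: "continuous_on {p..q} ?w"
    by (intro continuous_intros cont)
  define m where "m = (p + q) / 2"
  have m: "p < m" "m < q"
    using \<open>p < q\<close> by (simp_all add: m_def)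
  have neg: "?w m < 0" if "?w p \<le> 0" "?w q \<le> 0"
  proof -
    have "(\<forall>x\<in>{p..q}. ?w x = 0) \<or> (\<forall>x\<in>{p<..<q}. ?w x < 0)"
      by (rule strong_max_principle[OF um(1) S contw _ that]) (simp add: less_imp_le pos)
    moreover have "\<not> (\<forall>x\<in>{p..q}. ?w x = 0)"
    proof
      assume "\<forall>x\<in>{p..q}. ?w x = 0"
      hence "elliptic_op a b c ?w m \<le> 0"
        using m by (intro elliptic_op_nonpos_at_max[OF um(1) S m]) auto
      thus False
        using pos[OF m] by simp
    qed
    ultimately show ?thesis
      using m by auto
  qed
  show "u p < 0" if "u q = 0" and der: "(u has_real_derivative 0) (at q within {p..q})"
  proof (rule ccontr)
    assume "\<not> u p < 0"
    hence wm: "?w m < 0"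
      using neg that(1) by simp
    have "(0 :: real) < - 0"
    proof (rule hopf_right[of ?w m q])
      show "twice_differentiable_on ?w {m<..<q}"
        using um(1) by (rule twice_differentiable_on_subset) (use m in auto)
      show "continuous_on {m..q} ?w"
        using contw by (rule continuous_on_subset) (use m in auto)
      show "(?w has_real_derivative - 0) (at q within {m..q})"
        by (rule DERIV_minus, rule DERIV_subset[OF der]) (use m in auto)
      show "0 \<le> elliptic_op a b c ?w x" if "m < x" "x < q" for x
        using pos[of x] m that by simp
    qed (use S m wm that(1) in auto)
    thus False by simp
  qed
  show "u q < 0" if "u p = 0" and der: "(u has_real_derivative 0) (at p within {p..q})"
  proof (rule ccontr)
    assume "\<not> u q < 0"
    hence wm: "?w m < 0"
      using neg that(1) by simp
    have "- 0 < (0 :: real)"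
    proof (rule hopf_left[of ?w p m])
      show "twice_differentiable_on ?w {p<..<m}"
        using um(1) by (rule twice_differentiable_on_subset) (use m in auto)
      show "continuous_on {p..m} ?w"
        using contw by (rule continuous_on_subset) (use m in auto)
      show "(?w has_real_derivative - 0) (at p within {p..m})"
        by (rule DERIV_minus, rule DERIV_subset[OF der]) (use m in auto)
      show "0 \<le> elliptic_op a b c ?w x" if "p < x" "x < m" for x
        using pos[of x] m that by simp
    qed (use S m wm that(1) in auto)
    thus False by simp
  qed
qed

end

section \<open>The system with clamped boundary conditions\<close>

lemma elliptic_coefficients_ex:
  fixes a b c :: "real \<Rightarrow> real"
  assumes "bounded (b ` S)" "bounded (c ` S)" "0 < \<eta>"
    and "\<And>x. x \<in> S \<Longrightarrow> \<eta> \<le> a x" "\<And>x. x \<in> S \<Longrightarrow> c x \<le> 0"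
  obtains B C where "elliptic_coefficients a b c S \<eta> B C"
proof -
  obtain B where B: "0 < B" "\<And>x. x \<in> S \<Longrightarrow> \<bar>b x\<bar> \<le> B"
    using assms(1) unfolding bounded_pos by auto
  obtain C where C: "0 < C" "\<And>x. x \<in> S \<Longrightarrow> \<bar>c x\<bar> \<le> C"
    using assms(2) unfolding bounded_pos by auto
  have "- C \<le> c x" if "x \<in> S" for x
    using C(2)[OF that] by linarith
  hence "elliptic_coefficients a b c S \<eta> B C"
    using assms(3-5) B C(1) by unfold_locales auto
  thus thesis
    by (rule that)
qed

theorem theorem1p1:
  fixes a1 b1 c1 a2 b2 c2 u \<gamma> :: "real \<Rightarrow> real" and \<eta> :: real
  assumes "bounded (a1 ` {-1..1})" "bounded (b1 ` {-1..1})" "bounded (c1 ` {-1..1})"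
    and "bounded (a2 ` {-1..1})" "bounded (b2 ` {-1..1})" "bounded (c2 ` {-1..1})"
    and "\<eta> > 0"
    and "\<forall>x\<in>{-1..1}. min (a1 x) (a2 x) \<ge> \<eta>"
    and "\<forall>x\<in>{-1..1}. max (c1 x) (c2 x) \<le> 0"
    and "Ck_on 4 u {-1<..<1}" "Ck_on 2 u {-1..1}"
    and "Ck_on 2 \<gamma> {-1<..<1}" "continuous_on {-1..1} \<gamma>"
    and "\<forall>x\<in>{-1<..<1}. elliptic_op a1 b1 c1 u x = \<gamma> x"
    and "\<forall>x\<in>{-1<..<1}. elliptic_op a2 b2 c2 \<gamma> x \<le> 0"
    and "u (-1) = 0" "u 1 = 0"
    and "(u has_real_derivative 0) (at (-1) within {-1..1})"
    and "(u has_real_derivative 0) (at 1 within {-1..1})"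
  shows "(\<forall>x\<in>{-1..1}. u x = 0) \<or> (\<forall>x\<in>{-1<..<1}. u x < 0)"
proof -
  let ?I = "{-1<..<1} :: real set"
  have ell: "\<eta> \<le> a1 x" "\<eta> \<le> a2 x" "c1 x \<le> 0" "c2 x \<le> 0" if "x \<in> {-1..1}" for x
    using bspec[OF assms(8) that] bspec[OF assms(9) that] by simp_all
  obtain B1 C1 where "elliptic_coefficients a1 b1 c1 {-1..1} \<eta> B1 C1"
    by (rule elliptic_coefficients_ex[where a = a1, OF assms(2,3,7)]) (use ell in auto)
  then interpret L1: elliptic_coefficients a1 b1 c1 "{-1..1}" \<eta> B1 C1 .
  obtain B2 C2 where "elliptic_coefficients a2 b2 c2 {-1..1} \<eta> B2 C2"
    by (rule elliptic_coefficients_ex[where a = a2, OF assms(5,6,7)]) (use ell in auto)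
  then interpret L2: elliptic_coefficients a2 b2 c2 "{-1..1}" \<eta> B2 C2 .
  have cont_u: "continuous_on {p..q} u" if "-1 \<le> p" "q \<le> 1" for p q
  proof -
    from assms(11) obtain D where D: "D 0 = u \<and>
        (\<forall>j<2. \<forall>x\<in>{-1..1}. (D j has_real_derivative D (Suc j) x) (at x within {-1..1})) \<and>
        continuous_on {-1..1} (D 2)"
      unfolding Ck_on_def ..
    have "continuous_on {-1..1} u"
      by (rule DERIV_continuous_on[of _ _ "D 1"]) (use D in \<open>auto dest!: spec[of _ 0]\<close>)
    thus ?thesis
      by (rule continuous_on_subset) (use that in auto)
  qed
  have tw_g: "twice_differentiable_on \<gamma> ?I"
    using assms(12) by (rule Ck_on_2_twice_differentiable_on) simp
  have "Ck_on 2 u ?I"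
  proof -
    from assms(10) obtain D where D: "D 0 = u \<and>
        (\<forall>j<4. \<forall>x\<in>?I. (D j has_real_derivative D (Suc j) x) (at x within ?I)) \<and>
        continuous_on ?I (D 4)"
      unfolding Ck_on_def ..
    have "continuous_on ?I (D 2)"
      by (rule DERIV_continuous_on[of _ _ "D 3"]) (use D in \<open>auto dest!: spec[of _ 2]\<close>)
    thus ?thesis
      unfolding Ck_on_def using D by (intro exI[of _ D]) simp
  qed
  hence tw_u: "twice_differentiable_on u {p<..<q}" if "-1 \<le> p" "q \<le> 1" for p q
    by (rule twice_differentiable_on_subset[OF Ck_on_2_twice_differentiable_on]) (use that in auto)
  have L1u: "elliptic_op a1 b1 c1 u x = \<gamma> x" if "-1 < x" "x < 1" for x
    using assms(14) that by simp

  define P where "P = {x \<in> ?I. 0 \<le> \<gamma> x}"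
  have between: "0 \<le> \<gamma> x" if "y \<in> P" "z \<in> P" "y \<le> x" "x \<le> z" for x y z
  proof -
    have yz: "-1 < y" "z < 1" "0 \<le> \<gamma> y" "0 \<le> \<gamma> z"
      using that by (auto simp: P_def)
    have tw: "twice_differentiable_on \<gamma> {y<..<z}"
      using tw_g by (rule twice_differentiable_on_subset) (use yz in auto)
    note um = elliptic_op_uminus[OF tw open_greaterThanLessThan]
    have "- \<gamma> x \<le> 0"
    proof (rule L2.weak_max_principle[OF um(1)])
      show "continuous_on {y..z} (\<lambda>x. - \<gamma> x)"
        by (intro continuous_intros continuous_on_subset[OF assms(13)]) (use yz in auto)
      show "0 \<le> elliptic_op a2 b2 c2 (\<lambda>x. - \<gamma> x) t" if "y < t" "t < z" for t
        using um(2)[of t a2 b2 c2] assms(15) that yz by simp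
    qed (use yz that(3,4) in auto)
    thus ?thesis by simp
  qed

  have right: "u x < 0" if "-1 \<le> x" "x < 1" "\<And>y. x < y \<Longrightarrow> y < 1 \<Longrightarrow> \<gamma> y < 0" for x
  proof (rule L1.strict_supersolution_negative(1)[where u = u and p = x and q = 1])
    show "(u has_real_derivative 0) (at 1 within {x..1})"
      by (rule DERIV_subset[OF assms(19)]) (use that in auto)
  qed (use that L1u assms(17) tw_u cont_u in auto)
  have left: "u x < 0" if "-1 < x" "x \<le> 1" "\<And>y. -1 < y \<Longrightarrow> y < x \<Longrightarrow> \<gamma> y < 0" for x
  proof (rule L1.strict_supersolution_negative(2)[where u = u and p = "-1" and q = x])
    show "(u has_real_derivative 0) (at (-1) within {-1..x})"
      by (rule DERIV_subset[OF assms(18)]) (use that in auto)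
  qed (use that L1u assms(16) tw_u cont_u in auto)

  show ?thesis
  proof (cases "P = {}")
    case True
    hence "u x < 0" if "x \<in> ?I" for x
      using that by (intro right) (auto simp: P_def not_le)
    thus ?thesis by blast
  next
    case False
    define \<alpha> where "\<alpha> = Inf P"
    define \<beta> where "\<beta> = Sup P"
    have bdd: "bdd_below P" "bdd_above P"
      by (auto simp: P_def bdd_below_def bdd_above_def intro: less_imp_le)
    have P: "\<alpha> \<le> x" "x \<le> \<beta>" if "x \<in> P" for x
      using that bdd by (auto simp: \<alpha>_def \<beta>_def intro: cInf_lower cSup_upper)
    have range: "-1 \<le> \<alpha>" "\<beta> \<le> 1"
      using False by (auto simp: \<alpha>_def \<beta>_def P_def intro!: cInf_greatest cSup_least)
    obtain x0 where x0: "x0 \<in> P"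
      using False by auto
    have x0': "\<alpha> \<le> x0" "x0 \<le> \<beta>" "-1 < x0" "x0 < 1"
      using P x0 by (auto simp: P_def)
    have outer_left: "u x < 0" if "-1 < x" "x \<le> \<alpha>" for x
    proof (rule left)
      show "\<gamma> y < 0" if y: "-1 < y" "y < x" for y
      proof (rule ccontr)
        assume "\<not> \<gamma> y < 0"
        hence "y \<in> P"
          using y \<open>x \<le> \<alpha>\<close> x0' by (simp add: P_def)
        thus False
          using P(1)[of y] y \<open>x \<le> \<alpha>\<close> by simp
      qed
    qed (use that x0' in auto)
    have outer_right: "u x < 0" if "\<beta> \<le> x" "x < 1" for x
    proof (rule right)
      show "\<gamma> y < 0" if y: "x < y" "y < 1" for y
      proof (rule ccontr)
        assume "\<not> \<gamma> y < 0"
        hence "y \<in> P"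
          using y \<open>\<beta> \<le> x\<close> x0' by (simp add: P_def)
        thus False
          using P(2)[of y] y \<open>\<beta> \<le> x\<close> by simp
      qed
    qed (use that x0' in auto)
    have central: "0 \<le> \<gamma> x" if x: "\<alpha> < x" "x < \<beta>" for x
    proof -
      obtain y where "y \<in> P" "y < x"
        using x(1) cInf_less_iff[OF False bdd(1)] by (auto simp: \<alpha>_def)
      moreover obtain z where "z \<in> P" "x < z"
        using x(2) less_cSup_iff[OF False bdd(2)] by (auto simp: \<beta>_def)
      ultimately show ?thesis
        using between by (simp add: less_imp_le)
    qed
    \<comment> \<open>Either the end is \<open>\<plusminus>1\<close>, where \<open>u\<close> is zero, or it is the inner end of an outer piece.\<close>
    have ends: "u \<alpha> \<le> 0" "u \<beta> \<le> 0"
      using outer_left[of \<alpha>] outer_right[of \<beta>] range assms(16,17)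
      by (cases "\<alpha> = -1"; cases "\<beta> = 1"; simp)+
    have "(\<forall>x\<in>{\<alpha>..\<beta>}. u x = 0) \<or> (\<forall>x\<in>{\<alpha><..<\<beta>}. u x < 0)"
      by (rule L1.strong_max_principle[OF tw_u[OF range] _ cont_u[OF range] _ ends])
         (use range L1u central in auto)
    thus ?thesis
    proof
      assume zero: "\<forall>x\<in>{\<alpha>..\<beta>}. u x = 0"
      have "\<alpha> = -1" "\<beta> = 1"
        using bspec[OF zero, of \<alpha>] bspec[OF zero, of \<beta>] outer_left[of \<alpha>] outer_right[of \<beta>] range x0'
        by (cases "\<alpha> = -1"; cases "\<beta> = 1"; simp)+
      thus ?thesis
        using zero by simp
    next
      assume neg: "\<forall>x\<in>{\<alpha><..<\<beta>}. u x < 0"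
      have "u x < 0" if "x \<in> ?I" for x
        using outer_left[of x] outer_right[of x] neg that by (cases "x \<le> \<alpha>"; cases "\<beta> \<le> x") auto
      thus ?thesis by blast
    qed
  qed
qed

end
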